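(* Let $A$ be a finite-dimensional real alternative algebra with unity and a fixed antiinvolution $x\mapsto x^c$. If $Q_A\neq\mathbb{R}$, the following statements hold: (1) $Q_A=\bigcup_{J\in\mathbb{S}_A}\mathbb{C}_J$. (2) If $I,J\in\mathbb{S}_A$ and $I\neq\pm J$, then $\mathbb{C}_I\cap\mathbb{C}_J=\mathbb{R}$.
   Context: $A$ is a finite-dimensional real alternative algebra with unity, of real dimension $d>1$ (alternative: the associator $(x,y,z)=(xy)z-x(yz)$ is an alternating function of its arguments); $\mathbb{R}$ is identified with $\mathbb{R}\cdot 1\subseteq A$. An antiinvolution $x\mapsto x^c$ is a linear map $A\to A$ with $(x^c)^c=x$, $(xy)^c=y^cx^c$, and $x^c=x$ for every real $x$. Put $t(x)=x+x^c$ and $n(x)=xx^c$ (elements of $A$, not assumed real). Quadratic cone: $Q_A=\mathbb{R}\cup\{x\in A\mid t(x)\in\mathbb{R},\ n(x)\in\mathbb{R},\ 4n(x)>t(x)^2\}$. $\mathbb{S}_A=\{J\in Q_A\mid J^2=-1\}$. For $J\in\mathbb{S}_A$, $\mathbb{C}_J=\langle 1,J\rangle\simeq\mathbb{C}$ is the subalgebra of $A$ generated by $J$. *)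

theory Defs
  imports "HOL-Analysis.Analysis"
begin

text \<open>
  The library's algebra classes all include associativity, so the product is an explicit
  bilinear map on a real vector space.
\<close>

definition associator :: "('a::ab_group_add \<Rightarrow> 'a \<Rightarrow> 'a) \<Rightarrow> 'a \<Rightarrow> 'a \<Rightarrow> 'a \<Rightarrow> 'a" where
  "associator amul x y z = amul (amul x y) z - amul x (amul y z)"

text \<open>
  For a trilinear map over the reals, being alternating (vanishing when two arguments coincide)
  is the same as changing sign under transposition of any two arguments.
\<close>

locale alternative_algebra =
  fixes amul :: "'a::real_vector \<Rightarrow> 'a \<Rightarrow> 'a" and one :: 'a
  assumes finite_dimensional: "\<exists>B::'a set. finite B \<and> span B = UNIV"
    and bilinear_mult: "bilinear amul"
    and mult_one_left: "amul one x = x"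
    and mult_one_right: "amul x one = x"
    and associator_alternating:
      "x = y \<or> y = z \<or> x = z \<Longrightarrow> associator amul x y z = 0"

definition real_elements :: "'a::real_vector \<Rightarrow> 'a set" where
  "real_elements one = range (\<lambda>r. r *\<^sub>R one)"

locale antiinvolution =
  fixes amul :: "'a::real_vector \<Rightarrow> 'a \<Rightarrow> 'a" and one :: 'a and cj :: "'a \<Rightarrow> 'a"
  assumes linear_cj: "linear cj"
    and cj_cj: "cj (cj x) = x"
    and cj_mult: "cj (amul x y) = amul (cj y) (cj x)"
    and cj_real: "x \<in> real_elements one \<Longrightarrow> cj x = x"

definition trace_elt :: "('a::real_vector \<Rightarrow> 'a) \<Rightarrow> 'a \<Rightarrow> 'a" where
  "trace_elt cj x = x + cj x"

definition norm_elt :: "('a::real_vector \<Rightarrow> 'a \<Rightarrow> 'a) \<Rightarrow> ('a \<Rightarrow> 'a) \<Rightarrow> 'a \<Rightarrow> 'a" where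
  "norm_elt amul cj x = amul x (cj x)"

text \<open>
  Below, \<open>a\<close> and \<open>b\<close> are the real numbers identified with the trace and the norm of \<open>x\<close>;
  they are unique as soon as \<open>one \<noteq> 0\<close>.
\<close>

definition quadratic_cone ::
  "('a::real_vector \<Rightarrow> 'a \<Rightarrow> 'a) \<Rightarrow> 'a \<Rightarrow> ('a \<Rightarrow> 'a) \<Rightarrow> 'a set" where
  "quadratic_cone amul one cj = real_elements one \<union>
     {x. \<exists>a b. trace_elt cj x = a *\<^sub>R one \<and> norm_elt amul cj x = b *\<^sub>R one \<and> 4 * b > a\<^sup>2}"

definition imaginary_units ::
  "('a::real_vector \<Rightarrow> 'a \<Rightarrow> 'a) \<Rightarrow> 'a \<Rightarrow> ('a \<Rightarrow> 'a) \<Rightarrow> 'a set" where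
  "imaginary_units amul one cj = {J \<in> quadratic_cone amul one cj. amul J J = - one}"

definition unital_subalgebra :: "('a::real_vector \<Rightarrow> 'a \<Rightarrow> 'a) \<Rightarrow> 'a \<Rightarrow> 'a set \<Rightarrow> bool" where
  "unital_subalgebra amul one S \<longleftrightarrow>
     subspace S \<and> one \<in> S \<and> (\<forall>x\<in>S. \<forall>y\<in>S. amul x y \<in> S)"

definition complex_slice :: "('a::real_vector \<Rightarrow> 'a \<Rightarrow> 'a) \<Rightarrow> 'a \<Rightarrow> 'a \<Rightarrow> 'a set" where
  "complex_slice amul one J = unital_subalgebra amul one hull {J}"

text \<open>For an imaginary unit, the generated subalgebra is the plane spanned by \<open>one\<close> and \<open>J\<close>.\<close>

lemma (in alternative_algebra) complex_slice_eq_span: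
  assumes "amul J J = - one"
  shows "complex_slice amul one J = span {one, J}"
  unfolding complex_slice_def
proof (rule hull_unique)
  show "{J} \<subseteq> span {one, J}"
    by (simp add: span_base)
  have "amul x y \<in> span {one, J}" if xy: "x \<in> span {one, J}" "y \<in> span {one, J}" for x y
  proof -
    obtain a b c d where x: "x = a *\<^sub>R one + b *\<^sub>R J" and y: "y = c *\<^sub>R one + d *\<^sub>R J"
      using xy by (auto simp: span_insert span_singleton diff_eq_eq add.commute)
    have "amul x y = (a * c - b * d) *\<^sub>R one + (a * d + b * c) *\<^sub>R J"
      unfolding x y using assms bilinear_mult
      by (simp add: bilinear_ladd bilinear_radd bilinear_lmul bilinear_rmul
          mult_one_left mult_one_right algebra_simps)
    then show ?thesis
      by (simp add: span_add span_scale span_base)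
  qed
  then show "unital_subalgebra amul one (span {one, J})"
    by (auto simp: unital_subalgebra_def span_base)
next
  fix S assume "{J} \<subseteq> S" "unital_subalgebra amul one S"
  then show "span {one, J} \<subseteq> S"
    by (intro span_minimal) (auto simp: unital_subalgebra_def)
qed

end

theory Submission
  imports Defs
begin

text \<open>
  On \<open>J \<in> \<S>\<^sub>A\<close> the antiinvolution acts as \<open>J \<mapsto> -J\<close>: otherwise \<open>J\<^sup>2 = t(J) J - n(J)\<close> and
  \<open>J\<^sup>2 = -1\<close> would make \<open>J\<close> real. Hence it restricts to complex conjugation on each slice
  \<open>\<complex>\<^sub>J\<close>, which therefore lies in \<open>Q\<^sub>A\<close>. Conversely, a nonreal \<open>x \<in> Q\<^sub>A\<close> is a root of
  \<open>X\<^sup>2 - t(x) X + n(x)\<close>, which has negative discriminant; completing the square gives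
  \<open>x = t(x) / 2 + s J\<close> with \<open>J \<in> \<S>\<^sub>A\<close>.
\<close>

text \<open>With \<open>one \<noteq> 0\<close> the map \<open>r \<mapsto> r *\<^sub>R one\<close> is
  injective, so real coefficients of \<open>one\<close> may be compared.\<close>

locale alternative_star_algebra =
  alternative_algebra amul one + antiinvolution amul one cj
  for amul :: "'a::real_vector \<Rightarrow> 'a \<Rightarrow> 'a" and one cj +
  assumes one_nonzero: "one \<noteq> 0"
begin

lemmas mult_simps =
  bilinear_ladd[OF bilinear_mult] bilinear_radd[OF bilinear_mult]
  bilinear_lsub[OF bilinear_mult] bilinear_rsub[OF bilinear_mult]
  bilinear_lmul[OF bilinear_mult] bilinear_rmul[OF bilinear_mult]
  bilinear_lneg[OF bilinear_mult] bilinear_rneg[OF bilinear_mult]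
  mult_one_left mult_one_right

lemmas cj_simps =
  linear_add[OF linear_cj] linear_diff[OF linear_cj] linear_cmul[OF linear_cj]

lemma cj_one: "cj one = one"
  by (rule cj_real) (metis real_elements_def rangeI scaleR_one)

lemma scaleR_one_real: "r *\<^sub>R one \<in> real_elements one"
  unfolding real_elements_def by (rule rangeI)

lemma square_root_of_minus_one_not_real:
  assumes "amul J J = - one"
  shows "J \<notin> real_elements one"
proof
  assume "J \<in> real_elements one"
  then obtain r where "J = r *\<^sub>R one"
    by (auto simp: real_elements_def)
  with assms have "(r * r + 1) *\<^sub>R one = 0"
    by (simp add: mult_simps algebra_simps)
  then have "r * r + 1 = 0"
    using one_nonzero by simp
  then show False
    using zero_le_square[of r] by linarith
qed

lemma cj_imaginary_unit:
  assumes "J \<in> imaginary_units amul one cj"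
  shows "cj J = - J"
proof -
  have sq: "amul J J = - one" and "J \<in> quadratic_cone amul one cj"
    using assms by (auto simp: imaginary_units_def)
  then have nonreal: "J \<notin> real_elements one"
    by (simp add: square_root_of_minus_one_not_real)
  obtain a b where "J + cj J = a *\<^sub>R one" and norm: "amul J (cj J) = b *\<^sub>R one"
    using \<open>J \<in> quadratic_cone amul one cj\<close> nonreal
    by (auto simp: quadratic_cone_def trace_elt_def norm_elt_def)
  then have cj: "cj J = a *\<^sub>R one - J"
    by (simp add: algebra_simps)
  \<comment> \<open>Substituting \<open>a - J\<close> for the conjugate, the norm equation reads
    \<open>a J - J^2 = b\<close>, and \<open>J^2 = -1\<close>. A nonzero \<open>a\<close> would
    therefore make \<open>J\<close> real.\<close>
  have aJ: "a *\<^sub>R J = (b - 1) *\<^sub>R one"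
    using norm sq by (simp add: cj mult_simps algebra_simps)
  have "a = 0"
  proof (rule ccontr)
    assume "a \<noteq> 0"
    then have "J = ((b - 1) / a) *\<^sub>R one"
      using arg_cong[OF aJ, of "scaleR (1 / a)"] by simp
    with nonreal show False
      using scaleR_one_real by metis
  qed
  with cj show ?thesis by simp
qed

text \<open>The two equations give trace 0 and norm \<open>- J^2 = 1\<close>, so the cone inequality
  becomes 4 > 0.\<close>

lemma imaginary_unitI:
  assumes "cj J = - J" and "amul J J = - one"
  shows "J \<in> imaginary_units amul one cj"
proof -
  have "trace_elt cj J = 0 *\<^sub>R one" "norm_elt amul cj J = 1 *\<^sub>R one"
    using assms by (simp_all add: trace_elt_def norm_elt_def mult_simps)
  moreover have "4 * 1 > (0::real)\<^sup>2"
    by simp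
  ultimately have "J \<in> quadratic_cone amul one cj"
    unfolding quadratic_cone_def by blast
  with assms(2) show ?thesis
    by (simp add: imaginary_units_def)
qed

lemma mem_complex_slice_iff:
  assumes "J \<in> imaginary_units amul one cj"
  shows "x \<in> complex_slice amul one J \<longleftrightarrow> (\<exists>p q. x = p *\<^sub>R one + q *\<^sub>R J)"
proof -
  have "complex_slice amul one J = span {one, J}"
    using assms by (intro complex_slice_eq_span) (simp add: imaginary_units_def)
  then show ?thesis
    by (simp add: span_insert span_singleton image_iff diff_eq_eq add.commute)
qed

lemma real_elements_subset_complex_slice:
  assumes "J \<in> imaginary_units amul one cj"
  shows "real_elements one \<subseteq> complex_slice amul one J"
proof
  fix x assume "x \<in> real_elements one"
  then obtain r where "x = r *\<^sub>R one + 0 *\<^sub>R J"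
    by (auto simp: real_elements_def)
  then show "x \<in> complex_slice amul one J"
    using mem_complex_slice_iff[OF assms] by blast
qed

lemma complex_slice_subset_quadratic_cone:
  assumes "J \<in> imaginary_units amul one cj"
  shows "complex_slice amul one J \<subseteq> quadratic_cone amul one cj"
proof
  fix x assume "x \<in> complex_slice amul one J"
  then obtain p q where x: "x = p *\<^sub>R one + q *\<^sub>R J"
    using mem_complex_slice_iff[OF assms] by blast
  have sq: "amul J J = - one"
    using assms by (simp add: imaginary_units_def)
  have cjx: "cj x = p *\<^sub>R one - q *\<^sub>R J"
    by (simp add: x cj_simps cj_one cj_imaginary_unit[OF assms])
  show "x \<in> quadratic_cone amul one cj"
  \<comment> \<open>For \<open>q = 0\<close> the cone inequality degenerates to an equality, but
    then \<open>x\<close> is real and lies in the cone as such.\<close>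
  proof (cases "q = 0")
    case True
    then show ?thesis
      by (simp add: x quadratic_cone_def scaleR_one_real)
  next
    case False
    have "trace_elt cj x = (2 * p) *\<^sub>R one"
      unfolding trace_elt_def cjx by (simp add: x flip: scaleR_add_left)
    moreover have "norm_elt amul cj x = (p * p + q * q) *\<^sub>R one"
      unfolding norm_elt_def cjx by (simp add: x mult_simps sq algebra_simps)
    \<comment> \<open>The two sides differ by \<open>4 * q * q\<close>.\<close>
    moreover have "4 * (p * p + q * q) > (2 * p)\<^sup>2"
      using False by (simp add: power2_eq_square algebra_simps zero_less_mult_iff linorder_neq_iff disj_commute)
    ultimately show ?thesis
      unfolding quadratic_cone_def by blast
  qed
qed

lemma nonreal_quadratic_cone_in_slice:
  assumes "x \<in> quadratic_cone amul one cj" and "x \<notin> real_elements one"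
  shows "\<exists>J\<in>imaginary_units amul one cj. x \<in> complex_slice amul one J"
proof -
  obtain a b where "x + cj x = a *\<^sub>R one" and norm: "amul x (cj x) = b *\<^sub>R one"
    and disc: "4 * b > a\<^sup>2"
    using assms by (auto simp: quadratic_cone_def trace_elt_def norm_elt_def)
  then have cjx: "cj x = a *\<^sub>R one - x"
    by (simp add: algebra_simps)
  \<comment> \<open>The norm equation \<open>x (a - x) = b\<close>, solved for the square of
    \<open>x\<close>.\<close>
  have sq: "amul x x = a *\<^sub>R x - b *\<^sub>R one"
    using norm by (simp add: cjx mult_simps algebra_simps)
  define h where "h = a / 2"
  \<comment> \<open>As a rewrite rule this replaces the trace by \<open>h + h\<close>, so that
    completing the square below reduces to cancelling equal vectors.\<close>
  have a: "a *\<^sub>R v = h *\<^sub>R v + h *\<^sub>R v" for v :: 'a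
    by (simp add: h_def flip: scaleR_add_left)
  \<comment> \<open>The radicand is \<open>(4 * b - a\<^sup>2) / 4\<close>, positive by
    \<open>disc\<close>. Since \<open>y\<close> below squares to its negative, dividing
    \<open>y\<close> by \<open>s\<close> yields a square root of -1.\<close>
  define s where "s = sqrt (b - h * h)"
  have "b - h * h > 0"
    using disc by (simp add: h_def power2_eq_square)
  then have s: "s > 0" "s * s = b - h * h"
    by (simp_all add: s_def)
  define y where "y = x - h *\<^sub>R one"
  define J where "J = (1 / s) *\<^sub>R y"
  have "amul y y = - (s * s) *\<^sub>R one"
    unfolding y_def s(2) by (simp add: mult_simps sq a algebra_simps)
  then have "amul J J = - one"
    using s(1) by (simp add: J_def mult_simps)
  moreover have "cj y = - y"
    unfolding y_def by (simp add: cj_simps cj_one cjx a algebra_simps)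
  then have "cj J = - J"
    by (simp add: J_def cj_simps)
  ultimately have J: "J \<in> imaginary_units amul one cj"
    by (intro imaginary_unitI)
  have "x = h *\<^sub>R one + s *\<^sub>R J"
    using s(1) by (simp add: J_def y_def)
  with J show ?thesis
    using mem_complex_slice_iff by blast
qed

lemma quadratic_cone_eq_Union_slices:
  assumes "quadratic_cone amul one cj \<noteq> real_elements one"
  shows "quadratic_cone amul one cj =
           (\<Union>J\<in>imaginary_units amul one cj. complex_slice amul one J)"
proof
  \<comment> \<open>The real elements lie in every slice, so covering them takes at least one
    imaginary unit. A nonreal element of the cone provides it.\<close>
  obtain x where "x \<in> quadratic_cone amul one cj" "x \<notin> real_elements one"
    using assms by (auto simp: quadratic_cone_def)
  then obtain J where "J \<in> imaginary_units amul one cj"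
    using nonreal_quadratic_cone_in_slice by blast
  then show "quadratic_cone amul one cj
      \<subseteq> (\<Union>J\<in>imaginary_units amul one cj. complex_slice amul one J)"
    using nonreal_quadratic_cone_in_slice real_elements_subset_complex_slice by blast
qed (use complex_slice_subset_quadratic_cone in blast)

text \<open>A common element has imaginary parts \<open>q I = s J\<close>. Squaring both gives
  \<open>s = q\<close> or \<open>s = - q\<close>, so a nonzero \<open>q\<close> would force
  \<open>I = J\<close> or \<open>I = - J\<close>.\<close>

lemma complex_slice_Int:
  assumes I: "I \<in> imaginary_units amul one cj" and J: "J \<in> imaginary_units amul one cj"
    and neq: "I \<noteq> J" "I \<noteq> - J"
  shows "complex_slice amul one I \<inter> complex_slice amul one J = real_elements one"
proof
  show "real_elements one \<subseteq> complex_slice amul one I \<inter> complex_slice amul one J"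
    using real_elements_subset_complex_slice I J by blast
  show "complex_slice amul one I \<inter> complex_slice amul one J \<subseteq> real_elements one"
  proof
    fix x assume "x \<in> complex_slice amul one I \<inter> complex_slice amul one J"
    then obtain p q r s where x: "x = p *\<^sub>R one + q *\<^sub>R I" "x = r *\<^sub>R one + s *\<^sub>R J"
      using mem_complex_slice_iff I J by blast
    \<comment> \<open>Conjugation negates both units, so \<open>x - cj x\<close> is twice the
      imaginary part of \<open>x\<close> in either representation; the real parts \<open>p\<close>
      and \<open>r\<close> drop out.\<close>
    have "x - cj x = (2 * q) *\<^sub>R I"
      by (simp add: x(1) cj_simps cj_one cj_imaginary_unit[OF I] flip: scaleR_add_left)
    moreover have "x - cj x = (2 * s) *\<^sub>R J"
      by (simp add: x(2) cj_simps cj_one cj_imaginary_unit[OF J] flip: scaleR_add_left)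
    ultimately have double: "(2 * q) *\<^sub>R I = (2 * s) *\<^sub>R J"
      by simp
    have qs: "q *\<^sub>R I = s *\<^sub>R J"
      using arg_cong[OF double, of "scaleR (1 / 2)"] by simp
    have "amul (q *\<^sub>R I) (q *\<^sub>R I) = - (q * q) *\<^sub>R one"
      "amul (s *\<^sub>R J) (s *\<^sub>R J) = - (s * s) *\<^sub>R one"
      using I J by (simp_all add: imaginary_units_def mult_simps)
    with qs have "q * q = s * s"
      using one_nonzero by simp
    then have "s = q \<or> s = - q"
      by (auto simp: square_eq_iff)
    have "q = 0"
    proof (rule ccontr)
      assume "q \<noteq> 0"
      from \<open>s = q \<or> s = - q\<close> show False
      proof
        assume "s = q"
        with qs \<open>q \<noteq> 0\<close> neq(1) show False by simp
      next
        assume "s = - q"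
        with qs have "q *\<^sub>R I = q *\<^sub>R (- J)" by simp
        with \<open>q \<noteq> 0\<close> neq(2) show False
          by (metis scaleR_left_imp_eq)
      qed
    qed
    then show "x \<in> real_elements one"
      by (simp add: x(1) scaleR_one_real)
  qed
qed

end

theorem proposition3:
  fixes amul :: "'a::real_vector \<Rightarrow> 'a \<Rightarrow> 'a" and one :: 'a and cj :: "'a \<Rightarrow> 'a"
  assumes "alternative_algebra amul one"
    and "dim (UNIV :: 'a set) > 1"
    and "antiinvolution amul one cj"
    and "quadratic_cone amul one cj \<noteq> real_elements one"
  shows "quadratic_cone amul one cj =
           (\<Union>J\<in>imaginary_units amul one cj. complex_slice amul one J) \<and>
         (\<forall>I\<in>imaginary_units amul one cj. \<forall>J\<in>imaginary_units amul one cj.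
           I \<noteq> J \<and> I \<noteq> - J \<longrightarrow>
           complex_slice amul one I \<inter> complex_slice amul one J = real_elements one)"
proof -
  interpret alternative_algebra amul one by fact
  \<comment> \<open>If \<open>one = 0\<close>, the algebra is zero, so the cone and the real
    elements coincide, against the hypothesis.\<close>
  have "one \<noteq> 0"
  proof
    assume "one = 0"
    then have zero: "x = 0" for x :: 'a
      using mult_one_left[of x] bilinear_lzero[OF bilinear_mult] by simp
    have "x \<in> real_elements one" for x :: 'a
      unfolding real_elements_def by (subst zero[of x]) (rule range_eqI[of _ _ 0], simp)
    with assms(4) show False
      by (auto simp: quadratic_cone_def)
  qed
  then interpret alternative_star_algebra amul one cj
    using assms(1,3) by (simp add: alternative_star_algebra_def alternative_star_algebra_axioms_def)
  show ?thesis
    using quadratic_cone_eq_Union_slices[OF assms(4)] complex_slice_Int by blast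
qed

end
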